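(* Let $n,m$ be integers with $0\le m<n$, and suppose $\chi_n>c^2$. Let $t_1<\dots<t_n$ be the roots of $\psi_n$ in $(-1,1)$, $\Psi_n(1,t)=\int_0^1\psi_n(x)e^{-icxt}\,dx$, and $$P_{n,m}=\sum_{j=1}^n\frac{\psi_m(t_j)}{\psi_n'(t_j)}\Psi_n(1,t_j).$$ Then $c|P_{n,m}|\le\sqrt{32}\,n^2$.
   Context: For a real number $c>0$, let $F_c[\varphi](x)=\int_{-1}^1\varphi(t)e^{icxt}\,dt$ on $L^2[-1,1]$, with eigenvalues $\lambda_0,\lambda_1,\dots$ ordered so that $|\lambda_n|\ge|\lambda_{n+1}|$ and corresponding real eigenfunctions $\psi_0,\psi_1,\dots$ (prolate spheroidal wave functions) with $\|\psi_n\|_{L^2[-1,1]}=1$; $\psi_n$ has the parity of $n$ and exactly $n$ simple roots in $(-1,1)$. $\chi_0<\chi_1<\dots$ are the positive numbers such that $\psi_n$ satisfies $(1-x^2)\psi''(x)-2x\psi'(x)+(\chi_n-c^2x^2)\psi(x)=0$. *)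

theory Defs
  imports "HOL-Analysis.Analysis"
begin

definition finite_fourier :: "real \<Rightarrow> (real \<Rightarrow> real) \<Rightarrow> real \<Rightarrow> complex" where
  "finite_fourier c \<phi> x =
     integral {-1..1} (\<lambda>t. complex_of_real (\<phi> t) * exp (\<i> * complex_of_real (c * x * t)))"

text \<open>Characterisation of the prolate spheroidal wave functions psi_0, psi_1, ...
  for band limit c, with eigenvalues lambda_k of F_c (ordered by nonincreasing
  modulus) and the Sturm-Liouville eigenvalues chi_k.  The psi_k are regarded as
  real functions on the whole real line (their natural entire extension), which
  makes the derivatives at the endpoints +-1 meaningful.\<close>
definition pswf_system ::
  "real \<Rightarrow> (nat \<Rightarrow> real \<Rightarrow> real) \<Rightarrow> (nat \<Rightarrow> complex) \<Rightarrow> (nat \<Rightarrow> real) \<Rightarrow> bool" where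
  "pswf_system c \<psi> lam chi \<longleftrightarrow>
     (\<forall>k. continuous_on {-1..1} (\<psi> k)) \<and>
     (\<forall>k. \<forall>x\<in>{-1..1}. finite_fourier c (\<psi> k) x = lam k * complex_of_real (\<psi> k x)) \<and>
     (\<forall>k. cmod (lam (Suc k)) \<le> cmod (lam k)) \<and>
     (\<forall>k. integral {-1..1} (\<lambda>t. (\<psi> k t)\<^sup>2) = 1) \<and>
     (\<forall>k x. \<psi> k (- x) = (-1) ^ k * \<psi> k x) \<and>
     (\<forall>k. finite {x\<in>{-1<..<1}. \<psi> k x = 0} \<and> card {x\<in>{-1<..<1}. \<psi> k x = 0} = k) \<and>
     (\<forall>k. \<forall>x\<in>{-1<..<1}. \<psi> k x = 0 \<longrightarrow> deriv (\<psi> k) x \<noteq> 0) \<and>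
     strict_mono chi \<and> (\<forall>k. 0 < chi k) \<and>
     (\<forall>k x. \<psi> k differentiable at x) \<and>
     (\<forall>k x. deriv (\<psi> k) differentiable at x) \<and>
     (\<forall>k. \<forall>x\<in>{-1..1}.
        (1 - x\<^sup>2) * deriv (deriv (\<psi> k)) x - 2 * x * deriv (\<psi> k) x
          + (chi k - c\<^sup>2 * x\<^sup>2) * \<psi> k x = 0)"

definition Psi1 :: "real \<Rightarrow> (real \<Rightarrow> real) \<Rightarrow> real \<Rightarrow> complex" where
  "Psi1 c \<phi> t = integral {0..1} (\<lambda>x. complex_of_real (\<phi> x) * exp (- \<i> * complex_of_real (c * x * t)))"

definition P_nm :: "real \<Rightarrow> (nat \<Rightarrow> real \<Rightarrow> real) \<Rightarrow> nat \<Rightarrow> nat \<Rightarrow> complex" where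
  "P_nm c \<psi> n m = (\<Sum>t\<in>{x\<in>{-1<..<1}. \<psi> n x = 0}.
      complex_of_real (\<psi> m t / deriv (\<psi> n) t) * Psi1 c (\<psi> n) t)"

end

theory Submission
  imports Defs
begin

text \<open>
  Write \<open>\<chi>\<close> for \<open>\<chi>\<^sub>n\<close> and \<open>L = \<chi> + 1\<close>. The function \<open>u = sqrt (1 - x\<^sup>2) \<psi>\<^sub>n\<close> satisfies
  \<open>u'' + V u = 0\<close> on \<open>(-1, 1)\<close>, where \<open>\<chi> > c\<^sup>2\<close> makes \<open>V\<close> at least \<open>L = V 0\<close> and increasing in \<open>|x|\<close>.
  Comparing with \<open>sin (sqrt L (x - a))\<close>, every interval of length \<open>pi / sqrt L\<close> contains a root,
  so having only \<open>n\<close> roots forces \<open>sqrt L \<le> pi (n + 1) / 2\<close>.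

  Since \<open>V\<close> is monotone, \<open>V u\<^sup>2 + u'\<^sup>2\<close> grows and \<open>u\<^sup>2 + u'\<^sup>2 / V\<close> decays away from \<open>0\<close>. With \<open>A\<close> the value
  of the latter at \<open>0\<close> (the constant \<open>amp\<close>), this gives \<open>(1 - x\<^sup>2) \<psi>\<^sub>n\<^sup>2 \<le> A\<close> everywhere and
  \<open>(1 - t\<^sup>2) \<psi>\<^sub>n'(t)\<^sup>2 \<ge> L A\<close> at the roots. Near the endpoints \<open>\<psi>\<^sub>n\<close> varies only on the scale
  \<open>1 / L\<close>, so \<open>\<psi>\<^sub>n\<^sup>2 \<le> 8 L A\<close>, and integrating the smaller of the two bounds yields
  \<open>1 / 2 \<le> A (1 + ln (8 L))\<close>.

  Finally the energy identity for \<open>\<psi>\<^sub>m\<close> gives \<open>(1 - x\<^sup>2) \<psi>\<^sub>m\<^sup>2 \<le> 1 + sqrt L\<close>, and Cauchy-Schwarz gives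
  \<open>|\<Psi>\<^sub>n| \<le> 1 / sqrt 2\<close>. In each quotient \<open>\<psi>\<^sub>m(t) / \<psi>\<^sub>n'(t)\<close> the weights \<open>1 - t\<^sup>2\<close> cancel.
\<close>

section \<open>Weight and monotonicity on the open interval\<close>

lemma weight_pos: "x \<in> {-1<..<1} \<Longrightarrow> 0 < 1 - (x::real)\<^sup>2"
  by (auto simp: abs_square_less_1 abs_less_iff)

text \<open>Both energy functionals of \<open>u\<close> fit this pattern: their derivatives are
  \<open>V'\<close> times a square, up to sign, and \<open>V'\<close> has the sign of
  \<open>x\<close>.\<close>

lemma monotone_away_from_0:
  fixes g g' :: "real \<Rightarrow> real"
  assumes g: "\<And>x. x \<in> {-1<..<1} \<Longrightarrow> (g has_real_derivative g' x) (at x)"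
    and pos: "\<And>x. x \<in> {-1<..<1} \<Longrightarrow> 0 \<le> x \<Longrightarrow> 0 \<le> g' x"
    and neg: "\<And>x. x \<in> {-1<..<1} \<Longrightarrow> x \<le> 0 \<Longrightarrow> g' x \<le> 0"
    and x: "x \<in> {-1<..<1}"
  shows "g 0 \<le> g x"
proof (cases "0 \<le> x")
  case True
  then show ?thesis
  proof (rule DERIV_nonneg_imp_nondecreasing)
    fix y assume "0 \<le> y" "y \<le> x"
    then show "\<exists>d. (g has_real_derivative d) (at y) \<and> 0 \<le> d"
      using x g[of y] pos[of y] by auto
  qed
next
  case False
  then have "x \<le> 0" by simp
  then show ?thesis
  proof (rule DERIV_nonpos_imp_nonincreasing)
    fix y assume "x \<le> y" "y \<le> 0"
    then show "\<exists>d. (g has_real_derivative d) (at y) \<and> d \<le> 0"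
      using x g[of y] neg[of y] by auto
  qed
qed

section \<open>Energy identity and pointwise bounds for the prolate equation\<close>

locale prolate_ode =
  fixes c chi :: real and f f' f'' :: "real \<Rightarrow> real"
  assumes chi_pos: "0 < chi"
    and f_deriv: "\<And>x. (f has_real_derivative f' x) (at x)"
    and f'_deriv: "\<And>x. (f' has_real_derivative f'' x) (at x)"
    and ode: "\<And>x. x \<in> {-1..1} \<Longrightarrow>
      (1 - x\<^sup>2) * f'' x - 2 * x * f' x + (chi - c\<^sup>2 * x\<^sup>2) * f x = 0"
    and f_norm: "integral {-1..1} (\<lambda>x. (f x)\<^sup>2) = 1"
begin

lemma f_cont [continuous_intros]: "continuous_on S f"
  using f_deriv DERIV_isCont continuous_at_imp_continuous_on by blast

lemma f'_cont [continuous_intros]: "continuous_on S f'"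
  using f'_deriv DERIV_isCont continuous_at_imp_continuous_on by blast

text \<open>The equation in self-adjoint form. The flux \<open>(1 - x^2) * f' x\<close> vanishes at
  both endpoints, which removes boundary terms below.\<close>

lemma flux_deriv:
  assumes "x \<in> {-1..1}"
  shows "((\<lambda>x. (1 - x\<^sup>2) * f' x) has_real_derivative - (chi - c\<^sup>2 * x\<^sup>2) * f x) (at x)"
proof -
  have "((\<lambda>x. (1 - x\<^sup>2) * f' x) has_real_derivative
      (- (2 * x)) * f' x + f'' x * (1 - x\<^sup>2)) (at x)"
    by (auto intro!: derivative_eq_intros f'_deriv)
  moreover have "(- (2 * x)) * f' x + f'' x * (1 - x\<^sup>2) = - (chi - c\<^sup>2 * x\<^sup>2) * f x"
    using ode[OF assms] by (simp add: algebra_simps)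
  ultimately show ?thesis by simp
qed

text \<open>Multiply the self-adjoint equation by \<open>f\<close> and integrate by parts; then drop
  the nonnegative term \<open>c^2 x^2 f^2\<close>.\<close>

lemma energy_le: "integral {-1..1} (\<lambda>x. (1 - x\<^sup>2) * (f' x)\<^sup>2) \<le> chi"
proof -
  have "((\<lambda>x. (1 - x\<^sup>2) * (f' x)\<^sup>2 - (chi - c\<^sup>2 * x\<^sup>2) * (f x)\<^sup>2) has_integral
      ((1 - 1\<^sup>2) * f' 1) * f 1 - ((1 - (-1)\<^sup>2) * f' (-1)) * f (-1)) {-1..1}"
  proof (rule fundamental_theorem_of_calculus)
    fix x :: real assume x: "x \<in> {-1..1}"
    have "((\<lambda>x. ((1 - x\<^sup>2) * f' x) * f x) has_real_derivative
        (- (chi - c\<^sup>2 * x\<^sup>2) * f x) * f x + f' x * ((1 - x\<^sup>2) * f' x)) (at x)"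
      by (intro DERIV_mult flux_deriv f_deriv x)
    then have "((\<lambda>x. ((1 - x\<^sup>2) * f' x) * f x) has_real_derivative
        (1 - x\<^sup>2) * (f' x)\<^sup>2 - (chi - c\<^sup>2 * x\<^sup>2) * (f x)\<^sup>2) (at x)"
      by (simp add: algebra_simps power2_eq_square)
    then show "((\<lambda>x. ((1 - x\<^sup>2) * f' x) * f x) has_vector_derivative
        (1 - x\<^sup>2) * (f' x)\<^sup>2 - (chi - c\<^sup>2 * x\<^sup>2) * (f x)\<^sup>2) (at x within {-1..1})"
      using has_real_derivative_iff_has_vector_derivative has_field_derivative_at_within by blast
  qed simp
  then have "integral {-1..1} (\<lambda>x. (1 - x\<^sup>2) * (f' x)\<^sup>2 - (chi - c\<^sup>2 * x\<^sup>2) * (f x)\<^sup>2) = 0"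
    by (simp add: integral_unique)
  moreover have "integral {-1..1} (\<lambda>x. (1 - x\<^sup>2) * (f' x)\<^sup>2 - (chi - c\<^sup>2 * x\<^sup>2) * (f x)\<^sup>2)
     = integral {-1..1} (\<lambda>x. (1 - x\<^sup>2) * (f' x)\<^sup>2)
       - integral {-1..1} (\<lambda>x. (chi - c\<^sup>2 * x\<^sup>2) * (f x)\<^sup>2)"
    by (intro integral_diff integrable_continuous_interval continuous_intros)
  moreover have "integral {-1..1} (\<lambda>x. (chi - c\<^sup>2 * x\<^sup>2) * (f x)\<^sup>2)
      \<le> integral {-1..1} (\<lambda>x. chi * (f x)\<^sup>2)"
    by (intro integral_le integrable_continuous_interval continuous_intros mult_right_mono) auto
  moreover have "integral {-1..1} (\<lambda>x. chi * (f x)\<^sup>2) = chi"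
    using f_norm by simp
  ultimately show ?thesis by linarith
qed

text \<open>The left side vanishes at both endpoints, so its double is at most the total variation,
  which the norm and the energy control. Leaving \<open>s\<close> free allows a value taken from a
  larger eigenvalue.\<close>

lemma weighted_square_le:
  assumes s: "0 < s" "chi \<le> s\<^sup>2" and x: "x \<in> {-1..1}"
  shows "(1 - x\<^sup>2) * (f x)\<^sup>2 \<le> 1 + s"
proof -
  define g where "g x = (1 - x\<^sup>2) * (f x)\<^sup>2" for x
  define g' where "g' x = - (2 * x) * (f x)\<^sup>2 + 2 * (1 - x\<^sup>2) * f x * f' x" for x
  define D where "D x = (2 + s) * (f x)\<^sup>2 + (1 - x\<^sup>2) * (f' x)\<^sup>2 / s" for x
  have g': "(g has_real_derivative g' y) (at y)" for y
    unfolding g_def g'_def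
    by (auto intro!: derivative_eq_intros f_deriv simp: algebra_simps)
  have ftc: "integral {a..b} g' = g b - g a" if "a \<le> b" for a b
    by (rule integral_unique, rule fundamental_theorem_of_calculus[OF that])
      (use g' has_real_derivative_iff_has_vector_derivative has_field_derivative_at_within in blast)
  have cont: "continuous_on T g'" "continuous_on T D" for T
    unfolding g'_def D_def using s by (auto intro!: continuous_intros)
  have D: "\<bar>g' y\<bar> \<le> D y" if "y \<in> {-1..1}" for y
  proof -
    have p: "0 \<le> 1 - y\<^sup>2" "1 - y\<^sup>2 \<le> 1" using that by (auto simp: abs_square_le_1 abs_le_iff)
    \<comment> \<open>AM-GM with weight \<open>s\<close> balances the two contributions:
      \<open>s\<close> from the norm and at most \<open>chi / s <= s\<close> from the
      energy.\<close>
    have "0 \<le> (s * \<bar>f y\<bar> - \<bar>f' y\<bar>)\<^sup>2 / s" using s by simp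
    also have "\<dots> = s * (f y)\<^sup>2 + (f' y)\<^sup>2 / s - 2 * \<bar>f y\<bar> * \<bar>f' y\<bar>"
      using s by (simp add: power2_eq_square field_simps)
    finally have am: "2 * \<bar>f y\<bar> * \<bar>f' y\<bar> \<le> s * (f y)\<^sup>2 + (f' y)\<^sup>2 / s" by simp
    have "\<bar>g' y\<bar> \<le> \<bar>2 * y * (f y)\<^sup>2\<bar> + \<bar>2 * (1 - y\<^sup>2) * f y * f' y\<bar>"
      unfolding g'_def by linarith
    also have "\<bar>2 * y * (f y)\<^sup>2\<bar> \<le> 2 * (f y)\<^sup>2"
      using that by (auto simp: abs_mult abs_le_iff intro!: mult_left_le_one_le)
    also have "\<bar>2 * (1 - y\<^sup>2) * f y * f' y\<bar> = (1 - y\<^sup>2) * (2 * \<bar>f y\<bar> * \<bar>f' y\<bar>)"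
      using p by (simp add: abs_mult)
    also have "\<dots> \<le> (1 - y\<^sup>2) * (s * (f y)\<^sup>2 + (f' y)\<^sup>2 / s)"
      using am p by (intro mult_left_mono)
    also have "\<dots> = (1 - y\<^sup>2) * (s * (f y)\<^sup>2) + (1 - y\<^sup>2) * (f' y)\<^sup>2 / s"
      by (simp add: distrib_left)
    also have "(1 - y\<^sup>2) * (s * (f y)\<^sup>2) \<le> 1 * (s * (f y)\<^sup>2)"
      using p s by (intro mult_right_mono) auto
    finally show ?thesis unfolding D_def by (simp add: algebra_simps)
  qed
  have bd: "\<bar>g b - g a\<bar> \<le> integral {a..b} D" if "-1 \<le> a" "a \<le> b" "b \<le> 1" for a b
    unfolding ftc[OF that(2), symmetric] real_norm_def[symmetric]
    using that D cont
    by (intro integral_norm_bound_integral integrable_continuous_interval) auto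
  have "g 1 = 0" "g (-1) = 0" by (auto simp: g_def)
  \<comment> \<open>Reaching \<open>x\<close> from each endpoint uses the two halves of the integral
    of \<open>D\<close> once each, which gains the factor 2.\<close>
  then have "2 * g x \<le> integral {-1..x} D + integral {x..1} D"
    using bd[of "-1" x] bd[of x 1] x by auto
  also have "\<dots> = integral {-1..1} D"
    using x cont by (intro Henstock_Kurzweil_Integration.integral_combine integrable_continuous_interval) auto
  also have "\<dots> = integral {-1..1} (\<lambda>x. (2 + s) * (f x)\<^sup>2)
       + integral {-1..1} (\<lambda>x. (1 - x\<^sup>2) * (f' x)\<^sup>2 / s)"
    unfolding D_def using s
    by (intro integral_add integrable_continuous_interval continuous_intros) auto
  also have "\<dots> = (2 + s) + integral {-1..1} (\<lambda>x. (1 - x\<^sup>2) * (f' x)\<^sup>2) / s"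
    using f_norm by simp
  also have "integral {-1..1} (\<lambda>x. (1 - x\<^sup>2) * (f' x)\<^sup>2) / s \<le> s"
    using energy_le s by (simp add: field_simps power2_eq_square)
  finally show ?thesis by (simp add: g_def)
qed

text \<open>The flux is zero at the endpoint \<open>e\<close> on the side of \<open>x\<close> and
  has slope at most \<open>chi * S\<close>. Hence it is at most \<open>chi * S * (1 - |x|)\<close>
  in modulus, and the degenerate factor \<open>1 - |x|\<close> of the weight cancels.\<close>

lemma deriv_bound:
  assumes S: "\<And>y. y \<in> {-1..1} \<Longrightarrow> \<bar>f y\<bar> \<le> S" and c: "c\<^sup>2 \<le> chi" and x: "x \<in> {-1<..<1}"
  shows "\<bar>f' x\<bar> \<le> chi * S"
proof -
  define F where "F x = (1 - x\<^sup>2) * f' x" for x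
  define e :: real where "e = (if 0 \<le> x then 1 else -1)"
  have F: "(F has_real_derivative - (chi - c\<^sup>2 * y\<^sup>2) * f y) (at y within {-1..1})"
    if "y \<in> {-1..1}" for y
    unfolding F_def using flux_deriv[OF that] has_field_derivative_at_within by blast
  have "norm (F x - F e) \<le> (chi * S) * norm (x - e)"
  proof (rule field_differentiable_bound[OF _ F])
    fix y :: real assume y: "y \<in> {-1..1}"
    have y2: "y\<^sup>2 \<le> 1" using y by (auto simp: abs_square_le_1 abs_le_iff)
    have "c\<^sup>2 * y\<^sup>2 \<le> c\<^sup>2 * 1" using y2 by (intro mult_left_mono) auto
    then have "\<bar>chi - c\<^sup>2 * y\<^sup>2\<bar> \<le> chi" using c by auto
    then show "norm (- (chi - c\<^sup>2 * y\<^sup>2) * f y) \<le> chi * S"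
      using S[OF y] chi_pos unfolding real_norm_def abs_mult abs_minus_cancel
      by (intro mult_mono) auto
  qed (use x in \<open>auto simp: e_def\<close>)
  moreover have "F e = 0" by (simp add: F_def e_def)
  moreover have "norm (x - e) = 1 - \<bar>x\<bar>" using x by (auto simp: e_def)
  moreover have "\<bar>F x\<bar> = (1 - \<bar>x\<bar>) * ((1 + \<bar>x\<bar>) * \<bar>f' x\<bar>)"
  proof -
    have "1 - x\<^sup>2 = (1 - \<bar>x\<bar>) * (1 + \<bar>x\<bar>)" by (simp add: algebra_simps power2_eq_square)
    moreover have "\<bar>1 - \<bar>x\<bar>\<bar> = 1 - \<bar>x\<bar>" using x by auto
    ultimately show ?thesis by (simp add: F_def abs_mult)
  qed
  ultimately have "(1 - \<bar>x\<bar>) * ((1 + \<bar>x\<bar>) * \<bar>f' x\<bar>) \<le> (1 - \<bar>x\<bar>) * (chi * S)"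
    by (simp add: mult.commute)
  then have "(1 + \<bar>x\<bar>) * \<bar>f' x\<bar> \<le> chi * S"
    using x by (auto simp: mult_le_cancel_left)
  moreover have "1 * \<bar>f' x\<bar> \<le> (1 + \<bar>x\<bar>) * \<bar>f' x\<bar>" by (intro mult_right_mono) auto
  ultimately show ?thesis by linarith
qed

end

section \<open>Liouville normal form and its two energy functionals\<close>

locale prolate_supercritical = prolate_ode +
  assumes c_less: "c\<^sup>2 < chi"
begin

definition u :: "real \<Rightarrow> real" where
  "u x = sqrt (1 - x\<^sup>2) * f x"

definition u' :: "real \<Rightarrow> real" where
  "u' x = sqrt (1 - x\<^sup>2) * f' x - x * f x / sqrt (1 - x\<^sup>2)"

text \<open>The quotient \<open>(chi - c^2 x^2) / (1 - x^2)\<close> is split into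
  \<open>c^2 + (chi - c^2) / (1 - x^2)\<close>, so that \<open>chi > c^2\<close> makes each term
  nondecreasing in \<open>|x|\<close>. The last term comes from the factor
  \<open>sqrt (1 - x^2)\<close>.\<close>

definition V :: "real \<Rightarrow> real" where
  "V x = c\<^sup>2 + (chi - c\<^sup>2) / (1 - x\<^sup>2) + 1 / (1 - x\<^sup>2)\<^sup>2"

definition V' :: "real \<Rightarrow> real" where
  "V' x = x * (2 * (chi - c\<^sup>2) / (1 - x\<^sup>2)\<^sup>2 + 4 / (1 - x\<^sup>2) ^ 3)"

definition amp :: real where
  "amp = (u 0)\<^sup>2 + (u' 0)\<^sup>2 / (chi + 1)"

lemma u_deriv:
  assumes "x \<in> {-1<..<1}"
  shows "(u has_real_derivative u' x) (at x)"
  unfolding u_def u'_def using weight_pos[OF assms]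
  by (auto intro!: derivative_eq_intros f_deriv simp: field_simps)

lemma u'_deriv:
  assumes x: "x \<in> {-1<..<1}"
  shows "(u' has_real_derivative - V x * u x) (at x)"
proof -
  define R where "R x = sqrt (1 - x\<^sup>2)" for x :: real
  define r where "r = R x"
  have r: "0 < r" "1 - x\<^sup>2 = r\<^sup>2" using weight_pos[OF x] by (auto simp: r_def R_def)
  have "(R has_real_derivative - x / r) (at x)"
    unfolding R_def r_def using weight_pos[OF x]
    by (auto intro!: derivative_eq_intros simp: field_simps)
  then have d: "(u' has_real_derivative
      (- x / r * f' x + r * f'' x - ((f x + x * f' x) * r - x * f x * (- x / r)) / r\<^sup>2)) (at x)"
    unfolding u'_def R_def[symmetric] using r(1)
    by (auto intro!: derivative_eq_intros f_deriv f'_deriv simp: r_def[symmetric] power2_eq_square)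
  have f2: "f'' x = (2 * x * f' x - (chi - c\<^sup>2 * x\<^sup>2) * f x) / r\<^sup>2"
    using ode[of x] x r by (auto simp: field_simps)
  have "(- x / r * f' x + r * f'' x - ((f x + x * f' x) * r - x * f x * (- x / r)) / r\<^sup>2)
     = - ((chi - c\<^sup>2 * x\<^sup>2) * r\<^sup>2 + r\<^sup>2 + x\<^sup>2) * f x / r ^ 3"
    unfolding f2 using r by (simp add: field_simps power2_eq_square power3_eq_cube)
  also have "(chi - c\<^sup>2 * x\<^sup>2) * r\<^sup>2 + r\<^sup>2 + x\<^sup>2 = V x * (r\<^sup>2)\<^sup>2"
  proof -
    have x2: "x\<^sup>2 = 1 - r\<^sup>2" using r by simp
    show ?thesis unfolding V_def x2 using r
      by (simp add: field_simps power2_eq_square)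
  qed
  also have "- (V x * (r\<^sup>2)\<^sup>2) * f x / r ^ 3 = - V x * u x"
    using r unfolding u_def R_def[symmetric] r_def[symmetric]
    by (simp add: field_simps power2_eq_square power3_eq_cube)
  finally show ?thesis using d by simp
qed

lemma V_deriv:
  assumes x: "x \<in> {-1<..<1}"
  shows "(V has_real_derivative V' x) (at x)"
proof -
  define p where "p = 1 - x\<^sup>2"
  have p: "0 < p" using weight_pos[OF x] by (simp add: p_def)
  have "((\<lambda>y. c\<^sup>2 + (chi - c\<^sup>2) / y + 1 / y\<^sup>2) has_real_derivative
      - (chi - c\<^sup>2) / p\<^sup>2 - 2 / p ^ 3) (at p)"
    using p by (auto intro!: derivative_eq_intros simp: field_simps power2_eq_square power3_eq_cube)
  moreover have "((\<lambda>x. 1 - x\<^sup>2) has_real_derivative - (2 * x)) (at x)"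
    by (auto intro!: derivative_eq_intros)
  ultimately have "(V has_real_derivative (- (chi - c\<^sup>2) / p\<^sup>2 - 2 / p ^ 3) * - (2 * x)) (at x)"
    unfolding V_def p_def by (rule DERIV_chain2)
  moreover have "(- (chi - c\<^sup>2) / p\<^sup>2 - 2 / p ^ 3) * - (2 * x) = V' x"
    unfolding V'_def p_def[symmetric] using p by (simp add: field_simps)
  ultimately show ?thesis by simp
qed

lemma V_ge:
  assumes x: "x \<in> {-1<..<1}"
  shows "chi + 1 \<le> V x"
proof -
  have p: "0 < 1 - x\<^sup>2" "1 - x\<^sup>2 \<le> 1" using weight_pos[OF x] by auto
  have "chi - c\<^sup>2 \<le> (chi - c\<^sup>2) / (1 - x\<^sup>2)"
    using p c_less by (simp add: pos_le_divide_eq mult_left_le)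
  moreover have "1 \<le> 1 / (1 - x\<^sup>2)\<^sup>2"
    using p by (simp add: power_le_one)
  ultimately show ?thesis unfolding V_def by linarith
qed

lemma V_pos: "x \<in> {-1<..<1} \<Longrightarrow> 0 < V x"
  using V_ge chi_pos by fastforce

lemma V'_sgn:
  assumes x: "x \<in> {-1<..<1}"
  shows "0 \<le> x \<Longrightarrow> 0 \<le> V' x" "x \<le> 0 \<Longrightarrow> V' x \<le> 0"
  using weight_pos[OF x] c_less unfolding V'_def
  by (auto intro!: mult_nonneg_nonneg mult_nonpos_nonneg add_nonneg_nonneg)

lemma V_0: "V 0 = chi + 1"
  by (simp add: V_def)

text \<open>The cross terms \<open>2 V u u'\<close> cancel, so the derivative of the right side is
  \<open>V' u^2\<close>.\<close>

lemma energy_ge: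
  assumes x: "x \<in> {-1<..<1}"
  shows "(chi + 1) * amp \<le> V x * (u x)\<^sup>2 + (u' x)\<^sup>2"
proof -
  have "V 0 * (u 0)\<^sup>2 + (u' 0)\<^sup>2 \<le> V x * (u x)\<^sup>2 + (u' x)\<^sup>2"
  proof (rule monotone_away_from_0[where g' = "\<lambda>x. V' x * (u x)\<^sup>2"])
    fix y :: real assume y: "y \<in> {-1<..<1}"
    show "((\<lambda>x. V x * (u x)\<^sup>2 + (u' x)\<^sup>2) has_real_derivative V' y * (u y)\<^sup>2) (at y)"
      by (auto intro!: derivative_eq_intros u_deriv[OF y] u'_deriv[OF y] V_deriv[OF y]
          simp: algebra_simps power2_eq_square)
  qed (use x V'_sgn in \<open>auto intro!: mult_nonneg_nonneg mult_nonpos_nonneg\<close>)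
  then show ?thesis using chi_pos by (simp add: amp_def V_0 distrib_left)
qed

text \<open>Dividing the energy by \<open>V\<close> reverses its monotonicity: the derivative of
  \<open>u^2 + u'^2 / V\<close> is \<open>- V' (u' / V)^2\<close>. The negated function is used so
  that the same monotonicity lemma applies.\<close>

lemma u_square_le:
  assumes x: "x \<in> {-1<..<1}"
  shows "(u x)\<^sup>2 \<le> amp"
proof -
  have "- ((u 0)\<^sup>2 + (u' 0)\<^sup>2 / V 0) \<le> - ((u x)\<^sup>2 + (u' x)\<^sup>2 / V x)"
  proof (rule monotone_away_from_0[where g' = "\<lambda>x. V' x * (u' x / V x)\<^sup>2"])
    fix y :: real assume y: "y \<in> {-1<..<1}"
    show "((\<lambda>x. - ((u x)\<^sup>2 + (u' x)\<^sup>2 / V x)) has_real_derivative V' y * (u' y / V y)\<^sup>2) (at y)"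
      using V_pos[OF y]
      by (auto intro!: derivative_eq_intros u_deriv[OF y] u'_deriv[OF y] V_deriv[OF y]
          simp: field_simps power2_eq_square)
  qed (use x V'_sgn in \<open>auto intro!: mult_nonneg_nonneg mult_nonpos_nonneg\<close>)
  moreover have "0 \<le> (u' x)\<^sup>2 / V x" using V_pos[OF x] by simp
  ultimately show ?thesis by (simp add: amp_def V_0)
qed

lemma weighted_f_square_le:
  assumes x: "x \<in> {-1<..<1}"
  shows "(1 - x\<^sup>2) * (f x)\<^sup>2 \<le> amp"
  using u_square_le[OF x] weight_pos[OF x] by (simp add: u_def power_mult_distrib)

text \<open>At a root, \<open>u\<close> and the singular term of \<open>u'\<close> vanish, so only
  the weighted derivative is left in the energy.\<close>

lemma weighted_f'_square_ge:
  assumes x: "x \<in> {-1<..<1}" and 0: "f x = 0"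
  shows "(chi + 1) * amp \<le> (1 - x\<^sup>2) * (f' x)\<^sup>2"
  using energy_ge[OF x] weight_pos[OF x] 0 by (simp add: u_def u'_def power_mult_distrib)

section \<open>Sturm comparison and the count of roots\<close>

lemma root_in_interval:
  assumes s: "s = sqrt (chi + 1)" and a: "-1 < a" "b = a + pi / s" "b < 1"
  shows "\<exists>x\<in>{a..b}. f x = 0"
proof (rule ccontr)
  assume no: "\<not> ?thesis"
  have s0: "0 < s" "s\<^sup>2 = chi + 1" using s chi_pos by auto
  have ab: "a < b" using a s0 by simp
  have same_sign: "0 < f a * f x" if x: "x \<in> {a..b}" for x
  proof (rule ccontr)
    assume "\<not> 0 < f a * f x"
    then have "f a * f x \<le> 0" by simp
    then have "(f a \<le> 0 \<and> 0 \<le> f x) \<or> (f x \<le> 0 \<and> 0 \<le> f a)"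
      by (auto simp: mult_le_0_iff)
    then obtain z where "a \<le> z" "z \<le> x" "f z = 0"
      using IVT'[OF _ _ _ f_cont, of a 0 x] IVT2'[OF _ _ _ f_cont, of x 0 a] x
      by (metis atLeastAtMost_iff)
    then show False using no x by auto
  qed
  \<comment> \<open>The Wronskian of \<open>u\<close> and the comparison function
    \<open>sin (s * (x - a))\<close>. The factor \<open>f a\<close> treats both signs of
    \<open>f\<close> at once.\<close>
  define W where "W x = f a * (u' x * sin (s * (x - a)) - u x * (s * cos (s * (x - a))))" for x
  have "W b \<le> W a"
  proof (rule DERIV_nonpos_imp_nonincreasing[OF less_imp_le[OF ab]])
    fix x assume x: "a \<le> x" "x \<le> b"
    then have x1: "x \<in> {-1<..<1}" using a by auto
    have "(W has_real_derivative
        f a * ((s\<^sup>2 - V x) * u x * sin (s * (x - a)))) (at x)"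
      unfolding W_def
      by (auto intro!: derivative_eq_intros u_deriv[OF x1] u'_deriv[OF x1]
          simp: algebra_simps power2_eq_square)
    moreover have "f a * ((s\<^sup>2 - V x) * u x * sin (s * (x - a))) \<le> 0"
    proof -
      have "s * (x - a) \<le> s * (pi / s)" using x a s0 by (intro mult_left_mono) auto
      then have "0 \<le> sin (s * (x - a))" using x s0 by (intro sin_ge_zero) auto
      moreover have "s\<^sup>2 - V x \<le> 0" using V_ge[OF x1] s0 by simp
      moreover have "0 \<le> f a * f x * sqrt (1 - x\<^sup>2)"
        using same_sign[of x] x weight_pos[OF x1] by simp
      ultimately have "(s\<^sup>2 - V x) * ((f a * f x * sqrt (1 - x\<^sup>2)) * sin (s * (x - a))) \<le> 0"
        by (intro mult_nonpos_nonneg mult_nonneg_nonneg[of "f a * f x * sqrt (1 - x\<^sup>2)"])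
      then show ?thesis by (simp add: u_def mult_ac)
    qed
    ultimately show "\<exists>y. (W has_real_derivative y) (at x) \<and> y \<le> 0" by blast
  qed
  \<comment> \<open>The sine vanishes at both ends while the cosine goes from 1 to -1, which
    contradicts that \<open>W\<close> does not increase.\<close>
  moreover have "W a < 0" "0 < W b"
  proof -
    have "a \<in> {-1<..<1}" "b \<in> {-1<..<1}" using a ab by auto
    then have p: "0 < sqrt (1 - a\<^sup>2)" "0 < sqrt (1 - b\<^sup>2)" using weight_pos by auto
    have "W a = - (s * sqrt (1 - a\<^sup>2) * (f a * f a))" by (simp add: W_def u_def)
    then show "W a < 0" using p s0 same_sign[of a] ab by simp
    have "s * (b - a) = pi" using a s0 by simp
    then have "W b = s * sqrt (1 - b\<^sup>2) * (f a * f b)" by (simp add: W_def u_def)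
    then show "0 < W b" using p s0 same_sign[of b] ab by simp
  qed
  ultimately show False by simp
qed

lemma sqrt_chi_le:
  assumes fin: "finite {x\<in>{-1<..<1}. f x = 0}" and card: "card {x\<in>{-1<..<1}. f x = 0} = n"
  shows "sqrt (chi + 1) \<le> pi * (real n + 1) / 2"
proof (rule ccontr)
  define s where "s = sqrt (chi + 1)"
  have s0: "0 < s" using chi_pos by (simp add: s_def)
  assume "\<not> ?thesis"
  then have *: "pi * (real n + 1) / 2 < s" by (simp add: s_def)
  \<comment> \<open>Cut \<open>(-1, 1)\<close> into \<open>n + 1\<close> cells of width
    \<open>w\<close>. An interval of length \<open>pi / s < w\<close> fits centrally into each, with
    margin \<open>e\<close> on both sides, so there are \<open>n + 1\<close> distinct roots, one too
    many.\<close>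
  define w where "w = 2 / (real n + 1)"
  have w: "pi / s < w" using * s0 by (simp add: w_def field_simps)
  define e where "e = (w - pi / s) / 2"
  have e: "0 < e" "pi / s = w - 2 * e" using w by (auto simp: e_def add_divide_distrib diff_divide_distrib)
  define a where "a k = -1 + real k * w + e" for k
  have w0: "0 < w" by (simp add: w_def)
  have inside: "-1 < a k" "a k + pi / s < 1" if "k \<le> n" for k
  proof -
    have "0 \<le> real k * w" using w0 by simp
    then show "-1 < a k" unfolding a_def using e by linarith
    have "(real k + 1) * w \<le> (real n + 1) * w" using that w0 by (intro mult_right_mono) auto
    also have "\<dots> = 2" unfolding w_def by (simp add: field_simps)
    finally show "a k + pi / s < 1" using e by (simp add: a_def algebra_simps)
  qed
  have "\<exists>x\<in>{a k..a k + pi / s}. f x = 0" if "k \<le> n" for k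
    by (rule root_in_interval[OF s_def inside(1)[OF that] refl inside(2)[OF that]])
  then obtain r where r: "\<And>k. k \<le> n \<Longrightarrow> r k \<in> {a k..a k + pi / s} \<and> f (r k) = 0"
    by metis
  have sep: "r j < r k" if "j < k" "k \<le> n" for j k
  proof -
    have "(real j + 1) * w \<le> real k * w" using that w0 by (intro mult_right_mono) auto
    then show ?thesis using r[of j] r[of k] that e by (auto simp: a_def algebra_simps)
  qed
  have "inj_on r {..n}"
    by (rule inj_onI) (metis atMost_iff less_irrefl linorder_neqE_nat sep)
  moreover have "r ` {..n} \<subseteq> {x\<in>{-1<..<1}. f x = 0}"
    using r inside by fastforce
  ultimately have "card {..n} \<le> card {x\<in>{-1<..<1}. f x = 0}"
    using fin by (intro card_inj_on_le)
  then show False using card by simp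
qed

section \<open>Behaviour at the endpoints and lower bound for the amplitude\<close>

lemma f_square_le:
  assumes x: "x \<in> {-1..1}"
  shows "(f x)\<^sup>2 \<le> 8 * (chi + 1) * amp"
proof -
  obtain z where z: "z \<in> {-1..1}" "\<And>y. y \<in> {-1..1} \<Longrightarrow> \<bar>f y\<bar> \<le> \<bar>f z\<bar>"
    using continuous_attains_sup[of "{-1..1}" "\<lambda>x. \<bar>f x\<bar>"] continuous_on_rabs[OF f_cont]
    by auto
  \<comment> \<open>At distance \<open>d\<close> from the endpoints the slope bound costs at most
    half of the maximum, while the weight is still at least \<open>d\<close>. The factor 8 is 4 from
    halving times 2 from \<open>1 / d\<close>.\<close>
  define d where "d = 1 / (2 * (chi + 1))"
  have d: "0 < d" "d \<le> 1 / 2" "(chi + 1) * d = 1 / 2"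
    using chi_pos by (auto simp: d_def field_simps)
  define y where "y = max (- (1 - d)) (min (1 - d) z)"
  have y: "\<bar>y\<bar> \<le> 1 - d" "\<bar>z - y\<bar> \<le> d"
    using z(1) d unfolding y_def by auto
  have y1: "y \<in> {-1<..<1}" using y d by auto
  have lip: "\<bar>f z - f y\<bar> \<le> \<bar>f z\<bar> / 2"
  proof -
    have b: "\<bar>f' t\<bar> \<le> (chi + 1) * \<bar>f z\<bar>" if "t \<in> {-1<..<1}" for t
    proof -
      have "\<bar>f' t\<bar> \<le> chi * \<bar>f z\<bar>" using deriv_bound[OF z(2) _ that] c_less by auto
      also have "\<dots> \<le> (chi + 1) * \<bar>f z\<bar>" by (intro mult_right_mono) auto
      finally show ?thesis .
    qed
    have "\<bar>f z - f y\<bar> \<le> (chi + 1) * \<bar>f z\<bar> * \<bar>z - y\<bar>"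
    \<comment> \<open>The maximum may lie at an endpoint, but the mean value point lies strictly
      between \<open>z\<close> and \<open>y\<close>, where the slope bound is available.\<close>
    proof (cases "z = y")
      case False
      have "\<exists>t. min z y < t \<and> t < max z y \<and>
          f (max z y) - f (min z y) = (max z y - min z y) * f' t"
        using False by (intro MVT2 f_deriv) auto
      then obtain t where t: "min z y < t" "t < max z y"
        "f (max z y) - f (min z y) = (max z y - min z y) * f' t" by blast
      have t1: "t \<in> {-1<..<1}" using t z(1) y1 by (auto simp: min_def max_def split: if_splits)
      have "\<bar>f z - f y\<bar> = \<bar>f' t\<bar> * \<bar>z - y\<bar>"
        using arg_cong[OF t(3), of abs] by (auto simp: min_def max_def abs_mult abs_minus_commute split: if_splits)
      then show ?thesis using b[OF t1] by (simp add: mult_right_mono)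
    qed simp
    also have "\<dots> \<le> (chi + 1) * \<bar>f z\<bar> * d" using y chi_pos by (intro mult_left_mono) auto
    also have "\<dots> = ((chi + 1) * d) * \<bar>f z\<bar>" by simp
    also have "\<dots> = \<bar>f z\<bar> / 2" unfolding d(3) by simp
    finally show ?thesis .
  qed
  have "\<bar>f x\<bar> / 2 \<le> \<bar>f y\<bar>" using lip z(2)[OF x] by linarith
  then have "(\<bar>f x\<bar> / 2)\<^sup>2 \<le> \<bar>f y\<bar>\<^sup>2" by (intro power_mono) auto
  then have fx: "(f x)\<^sup>2 \<le> 4 * (f y)\<^sup>2" by (simp add: power_divide)
  have "d * 1 \<le> (1 - \<bar>y\<bar>) * (1 + \<bar>y\<bar>)" using y d by (intro mult_mono) auto
  also have "\<dots> = 1 - y\<^sup>2" by (simp add: algebra_simps power2_eq_square)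
  finally have "d * (f y)\<^sup>2 \<le> (1 - y\<^sup>2) * (f y)\<^sup>2" by (intro mult_right_mono) auto
  also have "\<dots> \<le> amp" by (rule weighted_f_square_le[OF y1])
  finally have "(f y)\<^sup>2 \<le> 2 * (chi + 1) * amp"
    using chi_pos by (simp add: d_def field_simps)
  then show ?thesis using fx by linarith
qed

lemma half_norm_le: "integral {0..1} (\<lambda>x. (f x)\<^sup>2) \<le> amp * (1 + ln (8 * (chi + 1)))"
proof -
  define L where "L = chi + 1"
  have L: "1 \<le> L" using chi_pos by (simp add: L_def)
  \<comment> \<open>The bounds \<open>amp / (1 - x)\<close> and \<open>8 * L * amp\<close> coincide
    at \<open>h\<close>; the integral is split there.\<close>
  define h where "h = 1 - 1 / (8 * L)"
  have h: "0 \<le> h" "h < 1" "1 - h = 1 / (8 * L)" using L by (auto simp: h_def field_simps)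
  have int: "(\<lambda>x. (f x)\<^sup>2) integrable_on {a..b}" for a b
    by (intro integrable_continuous_interval continuous_intros)
  have 1: "((\<lambda>x. amp / (1 - x)) has_integral (- amp * ln (1 - h)) - (- amp * ln (1 - 0))) {0..h}"
  proof (rule fundamental_theorem_of_calculus[OF h(1)])
    fix x assume "x \<in> {0..h}"
    then have "((\<lambda>x. - amp * ln (1 - x)) has_real_derivative amp / (1 - x)) (at x)"
      using h by (auto intro!: derivative_eq_intros simp: field_simps)
    then show "((\<lambda>x. - amp * ln (1 - x)) has_vector_derivative amp / (1 - x)) (at x within {0..h})"
      using has_real_derivative_iff_has_vector_derivative has_field_derivative_at_within by blast
  qed
  have "integral {0..h} (\<lambda>x. (f x)\<^sup>2) \<le> - amp * ln (1 - h)"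
  proof (rule has_integral_le[OF integrable_integral[OF int]])
    show "((\<lambda>x. amp / (1 - x)) has_integral - amp * ln (1 - h)) {0..h}" using 1 by simp
    fix x assume x: "x \<in> {0..h}"
    then have x1: "x \<in> {-1<..<1}" using h by auto
    have "x * x \<le> x * 1" using x h by (intro mult_left_mono) auto
    then have "(1 - x) * (f x)\<^sup>2 \<le> (1 - x\<^sup>2) * (f x)\<^sup>2"
      by (intro mult_right_mono) (auto simp: power2_eq_square)
    also have "\<dots> \<le> amp" by (rule weighted_f_square_le[OF x1])
    finally show "(f x)\<^sup>2 \<le> amp / (1 - x)" using x1 by (simp add: field_simps)
  qed
  also have "\<dots> = amp * ln (8 * L)" unfolding h(3) using L by (simp add: ln_div)
  finally have A: "integral {0..h} (\<lambda>x. (f x)\<^sup>2) \<le> amp * ln (8 * L)" .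
  have "integral {h..1} (\<lambda>x. (f x)\<^sup>2) \<le> integral {h..1} (\<lambda>x. 8 * L * amp)"
    using h f_square_le unfolding L_def by (intro integral_le int) auto
  also have "\<dots> = (1 - h) * (8 * L * amp)" using h by simp
  also have "\<dots> = amp" unfolding h(3) using L by simp
  finally have B: "integral {h..1} (\<lambda>x. (f x)\<^sup>2) \<le> amp" .
  have "integral {0..1} (\<lambda>x. (f x)\<^sup>2) =
      integral {0..h} (\<lambda>x. (f x)\<^sup>2) + integral {h..1} (\<lambda>x. (f x)\<^sup>2)"
    using h by (intro Henstock_Kurzweil_Integration.integral_combine[symmetric] int) auto
  with A B show ?thesis unfolding L_def by (simp add: algebra_simps)
qed

end

section \<open>Half-interval integrals and the numerical constant\<close>

lemma integral_even_half:
  fixes g :: "real \<Rightarrow> real"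
  assumes g: "continuous_on {-1..1} g" and even: "\<And>x. g (- x) = g x"
  shows "integral {-1..1} g = 2 * integral {0..1} g"
proof -
  have "integral {-1..0} g + integral {0..1} g = integral {-1..1} g"
    by (intro Henstock_Kurzweil_Integration.integral_combine integrable_continuous_interval g) auto
  moreover have "integral {-1..0} g = integral {0..1} g"
    using Henstock_Kurzweil_Integration.integral_reflect_real[of 1 0 g] even by simp
  ultimately show ?thesis by simp
qed

lemma cmod_Psi1_le:
  assumes cont: "continuous_on {0..1} \<phi>" and half: "integral {0..1} (\<lambda>x. (\<phi> x)\<^sup>2) = 1 / 2"
  shows "cmod (Psi1 c \<phi> t) \<le> 1 / sqrt 2"
proof -
  have i: "(\<lambda>x. (\<phi> x)\<^sup>2 * (sqrt 2 / 2) + sqrt 2 / 4) integrable_on {0..1}"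
    by (intro integrable_continuous_interval continuous_intros cont)
  have "cmod (Psi1 c \<phi> t) \<le> integral {0..1} (\<lambda>x. (\<phi> x)\<^sup>2 * (sqrt 2 / 2) + sqrt 2 / 4)"
    unfolding Psi1_def
  proof (rule integral_norm_bound_integral[OF _ i])
    show "(\<lambda>x. complex_of_real (\<phi> x) * exp (- \<i> * complex_of_real (c * x * t))) integrable_on {0..1}"
      by (intro integrable_continuous_interval continuous_intros cont)
    fix x :: real
    \<comment> \<open>Cauchy-Schwarz in pointwise form: the tangent estimate is sharp at
      \<open>1 / sqrt 2\<close>, the root mean square of \<open>\<phi>\<close> on
      \<open>[0, 1]\<close>.\<close>
    have "0 \<le> (sqrt 2 * \<bar>\<phi> x\<bar> - 1)\<^sup>2 * (sqrt 2 / 4)" by simp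
    also have "\<dots> = (\<phi> x)\<^sup>2 * (sqrt 2 / 2) + sqrt 2 / 4 - \<bar>\<phi> x\<bar>"
      by (simp add: power2_diff power_mult_distrib field_simps)
    finally show "norm (complex_of_real (\<phi> x) * exp (- \<i> * complex_of_real (c * x * t)))
        \<le> (\<phi> x)\<^sup>2 * (sqrt 2 / 2) + sqrt 2 / 4"
      by (simp add: norm_mult)
  qed
  also have "\<dots> = integral {0..1} (\<lambda>x. (\<phi> x)\<^sup>2 * (sqrt 2 / 2)) + integral {0..1} (\<lambda>x::real. sqrt 2 / 4)"
    by (intro integral_add integrable_continuous_interval continuous_intros cont)
  also have "\<dots> = 1 / sqrt 2"
    by (simp add: half) (simp add: field_simps)
  finally show ?thesis .
qed

text \<open>Both factors are bounded linearly in \<open>n\<close>, the logarithm by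
  \<open>ln n <= n - 1\<close>. The target is \<open>64 = 8^2\<close> because
  \<open>8 / sqrt 2 = sqrt 32\<close>.\<close>

lemma sqrt_log_factor_le:
  assumes n: "1 \<le> n" and s: "1 \<le> s" "s \<le> pi * (real n + 1) / 2"
  shows "(1 + s) * (2 * (1 + ln (8 * s\<^sup>2))) \<le> 64 * (real n)\<^sup>2"
proof -
  have n1: "1 \<le> real n" using n by simp
  note s(2)
  also have "pi * (real n + 1) / 2 \<le> pi * (2 * real n) / 2"
    using n1 by (intro divide_right_mono mult_left_mono) auto
  also have "\<dots> = pi * real n" by simp
  also have "pi * real n \<le> 63 / 20 * real n"
    using pi_approx by (intro mult_right_mono) auto
  finally have sn: "s \<le> 63 / 20 * real n" .
  have "8 * s\<^sup>2 \<le> 8 * (63 / 20 * real n)\<^sup>2" using sn s by (intro mult_left_mono power_mono) auto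
  also have "\<dots> \<le> 80 * (real n)\<^sup>2" by (simp add: power_mult_distrib power2_eq_square)
  finally have "ln (8 * s\<^sup>2) \<le> ln (80 * (real n)\<^sup>2)" using s n1 by simp
  also have "\<dots> = ln 80 + 2 * ln (real n)" using n1 by (simp add: ln_mult ln_realpow)
  also have "\<dots> \<le> 6 + 2 * (real n - 1)"
  proof -
    \<comment> \<open>The base \<open>5 / 2\<close> is the quadratic Taylor bound
      \<open>1 + 1 + 1 / 2 <= exp 1\<close>.\<close>
    have "(80::real) \<le> (5 / 2) ^ 6" by (simp add: power_numeral_reduce)
    also have "\<dots> \<le> exp 1 ^ 6"
      using exp_lower_Taylor_quadratic[of "1::real"] by (intro power_mono) auto
    also have "\<dots> = exp 6" by (simp add: exp_of_nat_mult[symmetric])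
    finally have "ln 80 \<le> ln (exp (6::real))" by (subst ln_le_cancel_iff) auto
    then have "ln 80 \<le> (6::real)" by simp
    then show ?thesis using ln_le_minus_one[of "real n"] n1 by simp
  qed
  finally have "1 + ln (8 * s\<^sup>2) \<le> 7 * real n" using n1 by simp
  moreover have "1 + s \<le> 83 / 20 * real n" using sn n1 by simp
  moreover have "0 \<le> ln (8 * s\<^sup>2)" using s one_le_power[of s 2] by (intro ln_ge_zero) linarith
  ultimately have "(1 + s) * (2 * (1 + ln (8 * s\<^sup>2))) \<le> (83 / 20 * real n) * (2 * (7 * real n))"
    using s n1 by (intro mult_mono) auto
  also have "\<dots> \<le> 64 * (real n)\<^sup>2" by (simp add: power2_eq_square)
  finally show ?thesis .
qed

section \<open>Application to the prolate functions and summation over the roots\<close>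

lemma pswf_prolate_ode:
  assumes "pswf_system c \<psi> lam chi"
  shows "prolate_ode c (chi k) (\<psi> k) (deriv (\<psi> k)) (deriv (deriv (\<psi> k)))"
  using assms unfolding pswf_system_def
  by unfold_locales (auto simp: DERIV_deriv_iff_real_differentiable)

theorem theorem61:
  fixes c :: real and \<psi> :: "nat \<Rightarrow> real \<Rightarrow> real" and lam :: "nat \<Rightarrow> complex"
    and chi :: "nat \<Rightarrow> real" and n m :: nat
  assumes "0 < c"
    and "pswf_system c \<psi> lam chi"
    and "m < n"
    and "chi n > c\<^sup>2"
  shows "c * cmod (P_nm c \<psi> n m) \<le> sqrt 32 * (real n)\<^sup>2"
proof -
  define Z where "Z = {x\<in>{-1<..<1}. \<psi> n x = 0}"
  interpret m: prolate_ode c "chi m" "\<psi> m" "deriv (\<psi> m)" "deriv (deriv (\<psi> m))"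
    by (rule pswf_prolate_ode[OF assms(2)])
  interpret n: prolate_ode c "chi n" "\<psi> n" "deriv (\<psi> n)" "deriv (deriv (\<psi> n))"
    by (rule pswf_prolate_ode[OF assms(2)])
  \<comment> \<open>Only index \<open>n\<close> is supercritical; \<open>chi m\<close> may lie below
    \<open>c^2\<close>, so \<psi> at \<open>m\<close> is controlled by the energy identity
    alone.\<close>
  interpret n: prolate_supercritical c "chi n" "\<psi> n" "deriv (\<psi> n)" "deriv (deriv (\<psi> n))"
    by unfold_locales (rule assms(4))
  have Z: "finite Z" "card Z = n"
    and parity: "\<And>x. \<psi> n (- x) = (-1) ^ n * \<psi> n x"
    and mono: "strict_mono chi"
    using assms(2) unfolding pswf_system_def Z_def by auto
  define s where "s = sqrt (chi n + 1)"
  have s: "1 \<le> s" "s\<^sup>2 = chi n + 1" using n.chi_pos by (auto simp: s_def)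
  have s_le: "s \<le> pi * (real n + 1) / 2"
    unfolding s_def using Z n.sqrt_chi_le by (simp add: Z_def)
  have half: "integral {0..1} (\<lambda>x. (\<psi> n x)\<^sup>2) = 1 / 2"
  proof -
    have "integral {-1..1} (\<lambda>x. (\<psi> n x)\<^sup>2) = 2 * integral {0..1} (\<lambda>x. (\<psi> n x)\<^sup>2)"
      by (intro integral_even_half continuous_intros n.f_cont)
        (simp add: parity power_mult_distrib flip: power_mult)
    then show ?thesis using n.f_norm by simp
  qed
  \<comment> \<open>Twice the factor in the half-norm bound, so that a half-norm of 1/2 gives
    \<open>1 <= n.amp * a\<close>.\<close>
  define a where "a = 2 * (1 + ln (8 * s\<^sup>2))"
  have "0 \<le> ln (8 * s\<^sup>2)" using s one_le_power[of s 2] by (intro ln_ge_zero) linarith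
  then have a: "0 < a" by (simp add: a_def)
  have "1 \<le> n.amp * a"
    using n.half_norm_le half unfolding a_def s by (simp add: algebra_simps)
  moreover from this have "0 < n.amp * a" by simp
  then have "0 < n.amp" using a by (simp add: zero_less_mult_iff)
  ultimately have amp: "0 < n.amp" "1 / n.amp \<le> a" by (auto simp: field_simps)
  have quotient_le: "c * \<bar>\<psi> m t / deriv (\<psi> n) t\<bar> \<le> 8 * real n" if "t \<in> Z" for t
  proof -
    have t: "t \<in> {-1<..<1}" "\<psi> n t = 0" using that by (auto simp: Z_def)
    define p where "p = 1 - t\<^sup>2"
    have p: "0 < p" using weight_pos[OF t(1)] by (simp add: p_def)
    \<comment> \<open>The free parameter is \<open>s\<close> of index \<open>n\<close>; it is
      admissible because \<open>chi m < chi n <= s^2\<close>.\<close>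
    have up: "p * (\<psi> m t)\<^sup>2 \<le> 1 + s"
      unfolding p_def using s t strict_monoD[OF mono assms(3)]
      by (intro m.weighted_square_le) auto
    have low: "s\<^sup>2 * n.amp \<le> p * (deriv (\<psi> n) t)\<^sup>2"
      using n.weighted_f'_square_ge[OF t] s by (simp add: p_def)
    have pos: "0 < s\<^sup>2 * n.amp" using s amp by (simp add: n.chi_pos add_pos_pos)
    have "(c * \<bar>\<psi> m t / deriv (\<psi> n) t\<bar>)\<^sup>2
        = c\<^sup>2 * ((p * (\<psi> m t)\<^sup>2) / (p * (deriv (\<psi> n) t)\<^sup>2))"
      using p by (simp add: power_mult_distrib power_divide)
    \<comment> \<open>By \<open>c^2 < chi n <= s^2\<close>, the factor \<open>c^2\<close> is
      absorbed by the \<open>s^2\<close> in the lower bound for the derivative.\<close>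
    also have "\<dots> \<le> s\<^sup>2 * ((1 + s) / (s\<^sup>2 * n.amp))"
    proof (rule mult_mono)
      show "p * (\<psi> m t)\<^sup>2 / (p * (deriv (\<psi> n) t)\<^sup>2) \<le> (1 + s) / (s\<^sup>2 * n.amp)"
        using s by (intro frac_le up low pos) simp
    qed (use s p assms(4) n.chi_pos in auto)
    also have "\<dots> = (1 + s) * (1 / n.amp)" using s n.chi_pos by simp
    also have "\<dots> \<le> (1 + s) * a" using amp s by (intro mult_left_mono) auto
    also have "\<dots> \<le> 64 * (real n)\<^sup>2"
      unfolding a_def using assms(3) by (intro sqrt_log_factor_le s s_le) auto
    also have "\<dots> = (8 * real n)\<^sup>2" by (simp add: power_mult_distrib)
    finally show ?thesis by (rule power2_le_imp_le) simp
  qed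
  have "c * cmod (P_nm c \<psi> n m) \<le>
      c * (\<Sum>t\<in>Z. \<bar>\<psi> m t / deriv (\<psi> n) t\<bar> * cmod (Psi1 c (\<psi> n) t))"
    unfolding P_nm_def Z_def[symmetric] using assms(1)
    by (intro mult_left_mono order_trans[OF norm_sum] sum_mono) (auto simp: norm_mult norm_divide)
  also have "\<dots> = (\<Sum>t\<in>Z. (c * \<bar>\<psi> m t / deriv (\<psi> n) t\<bar>) * cmod (Psi1 c (\<psi> n) t))"
    by (simp add: sum_distrib_left mult.assoc)
  \<comment> \<open>One factor \<open>n\<close> is in each term; the other is the number of
    roots.\<close>
  also have "\<dots> \<le> (\<Sum>t\<in>Z. (8 * real n) * (1 / sqrt 2))"
    by (rule sum_mono, rule mult_mono[OF quotient_le cmod_Psi1_le[OF n.f_cont half]]) auto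
  also have "\<dots> = (8 / sqrt 2) * (real n)\<^sup>2" using Z by (simp add: power2_eq_square)
  also have "8 / sqrt 2 = sqrt 32"
    using real_sqrt_mult[of 16 2] by (simp add: field_simps)
  finally show ?thesis .
qed

end
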